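(* Let $k$ be a field with $|k|>2$ and let $n\ge 1$ be an integer. Then $$\Bigl\lfloor \frac{n}{2}\Bigr\rfloor+1\le \mathrm{mat}_k(n)\le n+1.$$
   Context: For a field $k$ and a natural number $n$, $\mathrm{mat}_k(n)$ is the minimal $r$ such that every graph on $n$ vertices can be represented in the matrix algebra $\mathrm{M}_{r,r}(k)$ of $r\times r$ matrices over $k$, where the graph's edges encode non-commutation. Here graphs are simple and undirected, and a representation of a graph $\Gamma$ with vertex set $W$ in $\mathrm{M}_{r,r}(k)$ is an assignment $w\mapsto x_w\in\mathrm{M}_{r,r}(k)$, $w \in W$, such that for all distinct $v,w\in W$ the vertices $v,w$ are joined by an edge if and only if $x_vx_w\ne x_wx_v$. *)

theory Defs
  imports "Jordan_Normal_Form.Matrix" "Graph_Theory.Pair_Digraph"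
begin

text \<open>
  A finite simple undirected graph is a \<open>pair_graph\<close>: its arc relation is symmetric and
  loop-free, and an undirected edge is a pair of opposite arcs.
\<close>

definition represents :: "('v \<Rightarrow> 'k::field mat) \<Rightarrow> 'v pair_pre_digraph \<Rightarrow> nat \<Rightarrow> bool" where
  "represents x G r \<longleftrightarrow>
     (\<forall>w\<in>pverts G. x w \<in> carrier_mat r r) \<and>
     (\<forall>v\<in>pverts G. \<forall>w\<in>pverts G. v \<noteq> w \<longrightarrow> ((v, w) \<in> parcs G \<longleftrightarrow> x v * x w \<noteq> x w * x v))"

text \<open>
  Taking vertices among the natural numbers loses nothing, since every graph on \<open>n\<close> vertices
  is isomorphic to one of these.
\<close>

definition all_graphs_representable :: "'k::field itself \<Rightarrow> nat \<Rightarrow> nat \<Rightarrow> bool" where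
  "all_graphs_representable _ n r \<longleftrightarrow>
     (\<forall>G :: nat pair_pre_digraph. pair_graph G \<and> card (pverts G) = n \<longrightarrow>
        (\<exists>x :: nat \<Rightarrow> 'k mat. represents x G r))"

text \<open>
  The size \<open>r\<close> ranges over positive integers: with 0-by-0 matrices allowed, the value at
  \<open>n = 1\<close> would be 0.
\<close>

definition mat_num :: "'k::field itself \<Rightarrow> nat \<Rightarrow> nat" where
  "mat_num k n = (LEAST r. r \<ge> 1 \<and> all_graphs_representable k n r)"

end

theory Submission
  imports Defs "HOL-Computational_Algebra.Polynomial"
begin

text \<open>
  Lower bound. The graph that forces large matrices is a matching with \<open>n div 2\<close> edges. Suppose
  its vertices are represented by \<open>r \<times> r\<close> matrices, and let \<open>W\<close> be the set of matched
  vertices. Choose a column \<open>v\<close> and a row \<open>f\<close>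
  with \<open>f A v \<noteq> 0\<close> for every nonzero matrix \<open>A\<close> over the base field. For \<open>r > 1\<close> no
  such pair has its entries in the field itself, but the polynomials
  \<open>v\<^sub>j = X\<^sup>j\<close>, \<open>f\<^sub>i = X\<^bsup>ri\<^esup>\<close> will do, since then the entries of \<open>A\<close> are the
  coefficients of \<open>f A v\<close>. For \<open>u = (\<Sum>w\<in>W. z w * x w)\<close> the requirements that \<open>u v\<close> be a
  multiple of \<open>v\<close> and \<open>f u\<close> a multiple of \<open>f\<close> amount to \<open>2 * (r - 1)\<close> linear equations on
  the coefficients \<open>z\<close>, because \<open>v\<close> and \<open>f\<close> have an entry \<open>1\<close>. If there were more than
  \<open>2 * (r - 1)\<close> matched vertices, some \<open>z \<noteq> 0\<close> would satisfy them. Both multiples have the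
  same factor, as \<open>f v \<noteq> 0\<close>, and hence \<open>f (u y - y u) v = 0\<close> for every matrix \<open>y\<close>
  (\<open>ex_commutator_relation\<close>). Taking for \<open>y\<close> the partner of a matched vertex \<open>w\<close> leaves
  only the term of \<open>w\<close> in this sum, so \<open>z w = 0\<close>, a contradiction
  (\<open>matching_commutators_bound\<close>).

  Upper bound. In the Heisenberg algebra of matrices with a row \<open>p\<close> on top and a column \<open>q\<close>
  at the right, the product of \<open>(p, q)\<close> and \<open>(p', q')\<close> is the corner unit times the scalar
  \<open>p \<bullet> q'\<close>. Number the vertices, let \<open>p\<close> be a unit vector and let
  \<open>q\<close> record the edges to earlier vertices. Then \<open>p \<bullet> q'\<close> is
  \<open>1\<close> if the first vertex precedes the second and is adjacent to it, and \<open>0\<close> otherwise,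
  so two vertices commute exactly if they are not adjacent. As the last vertex precedes no
  other, \<open>n - 1\<close> coordinates for \<open>p\<close> and \<open>q\<close> suffice, which gives matrices of size
  \<open>n + 1\<close> (\<open>all_graphs_representable_Suc\<close>).
\<close>

section \<open>Homogeneous linear systems\<close>

text \<open>
  Gaussian elimination with cross-multiplication in place of division, so that it applies
  to polynomial coefficients directly.
\<close>

lemma homogeneous_system_nontrivial_solution:
  fixes c :: "'e \<Rightarrow> 's \<Rightarrow> 'a::idom"
  assumes "finite E" "finite S" "card E < card S"
  shows "\<exists>z. (\<exists>s\<in>S. z s \<noteq> 0) \<and> (\<forall>e\<in>E. (\<Sum>s\<in>S. c e s * z s) = 0)"
  using assms
proof (induction E arbitrary: S c rule: finite_induct)
  case empty
  then have "S \<noteq> {}" by auto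
  then show ?case by (intro exI[of _ "\<lambda>_. 1"]) auto
next
  case (insert e E)
  show ?case
  proof (cases "\<forall>s\<in>S. c e s = 0")
    case True
    obtain z where "\<exists>s\<in>S. z s \<noteq> 0" "\<forall>e\<in>E. (\<Sum>s\<in>S. c e s * z s) = 0"
      using insert.IH[of S c] insert.prems insert.hyps by auto
    with True show ?thesis by (intro exI[of _ z]) auto
  next
    case False
    then obtain t where t: "t \<in> S" "c e t \<noteq> 0" by auto
    let ?S = "S - {t}"
    have "finite ?S" "card E < card ?S"
      using insert.prems insert.hyps t by simp_all
    from insert.IH[OF this, of "\<lambda>e' s. c e t * c e' s - c e' t * c e s"]
    obtain z where z: "\<exists>s\<in>?S. z s \<noteq> 0"
      "\<forall>e'\<in>E. (\<Sum>s\<in>?S. (c e t * c e' s - c e' t * c e s) * z s) = 0"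
      by (elim exE conjE)
    \<comment> \<open>The value at the pivot \<open>t\<close> solves equation \<open>e\<close>; scaling the other values by the
      pivot coefficient avoids the division.\<close>
    define y where "y s = (if s = t then - (\<Sum>s\<in>?S. c e s * z s) else c e t * z s)" for s
    have y: "(\<Sum>s\<in>S. c e' s * y s) = (\<Sum>s\<in>?S. (c e t * c e' s - c e' t * c e s) * z s)" for e'
    proof -
      have "(\<Sum>s\<in>S. c e' s * y s) = c e' t * y t + (\<Sum>s\<in>?S. c e' s * y s)"
        using insert.prems t by (simp add: sum.remove)
      also have "(\<Sum>s\<in>?S. c e' s * y s) = (\<Sum>s\<in>?S. c e' s * (c e t * z s))"
        by (rule sum.cong) (auto simp: y_def)
      finally show ?thesis
        by (simp add: y_def sum_distrib_left sum_subtractf algebra_simps)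
    qed
    show ?thesis
    proof (intro exI[of _ y] conjI ballI)
      show "\<exists>s\<in>S. y s \<noteq> 0" using z(1) t by (auto simp: y_def)
      show "(\<Sum>s\<in>S. c e' s * y s) = 0" if "e' \<in> insert e E" for e'
        using that z(2) y[of e'] by (auto simp: mult.commute)
    qed
  qed
qed

section \<open>A generic bilinear form\<close>

text \<open>
  In terms of the row \<open>f\<^sub>i = X\<^bsup>ri\<^esup>\<close> and the column \<open>v\<^sub>j = X\<^sup>j\<close>, the three functions below
  give the entries of \<open>f A\<close>, the entries of \<open>A v\<close>, and the scalar \<open>f A v\<close>.
\<close>

definition gen_row :: "nat \<Rightarrow> 'a::comm_ring_1 mat \<Rightarrow> nat \<Rightarrow> 'a poly" where
  "gen_row r A j = (\<Sum>i<r. monom (A $$ (i, j)) (r * i))"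

definition gen_col :: "nat \<Rightarrow> 'a::comm_ring_1 mat \<Rightarrow> nat \<Rightarrow> 'a poly" where
  "gen_col r A i = (\<Sum>j<r. monom (A $$ (i, j)) j)"

definition gen_form :: "nat \<Rightarrow> 'a::comm_ring_1 mat \<Rightarrow> 'a poly" where
  "gen_form r A = (\<Sum>i<r. \<Sum>j<r. monom (A $$ (i, j)) (r * i + j))"

lemma gen_form_eq_sum_row: "gen_form r A = (\<Sum>l<r. gen_row r A l * monom 1 l)"
  unfolding gen_form_def gen_row_def
  by (subst sum.swap) (simp add: sum_distrib_right mult_monom)

lemma gen_form_eq_sum_col: "gen_form r A = (\<Sum>l<r. monom 1 (r * l) * gen_col r A l)"
  unfolding gen_form_def gen_col_def by (simp add: sum_distrib_left mult_monom)

lemma monom_sum: "monom (\<Sum>i\<in>S. g i) d = (\<Sum>i\<in>S. monom (g i) d)"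
  by (induction S rule: infinite_finite_induct) (simp_all flip: add_monom)

text \<open>This is associativity, \<open>f (A C) v = (f A) (C v)\<close>.\<close>

lemma gen_form_mult:
  assumes "A \<in> carrier_mat r r" "C \<in> carrier_mat r r"
  shows "gen_form r (A * C) = (\<Sum>l<r. gen_row r A l * gen_col r C l)"
proof -
  have "gen_form r (A * C) =
      (\<Sum>i<r. \<Sum>j<r. \<Sum>l<r. monom (A $$ (i, l) * C $$ (l, j)) (r * i + j))"
    unfolding gen_form_def using assms
    by (intro sum.cong refl) (simp add: scalar_prod_def monom_sum lessThan_atLeast0)
  also have "\<dots> = (\<Sum>i<r. \<Sum>l<r. \<Sum>j<r. monom (A $$ (i, l) * C $$ (l, j)) (r * i + j))"
    by (rule sum.cong[OF refl]) (rule sum.swap)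
  also have "\<dots> = (\<Sum>l<r. \<Sum>i<r. \<Sum>j<r. monom (A $$ (i, l) * C $$ (l, j)) (r * i + j))"
    by (rule sum.swap)
  finally show ?thesis
    by (simp add: gen_row_def gen_col_def sum_product mult_monom)
qed

lemma gen_form_diff:
  assumes "A \<in> carrier_mat r r" "C \<in> carrier_mat r r"
  shows "gen_form r (A - C) = gen_form r A - gen_form r C"
  using assms by (simp add: gen_form_def sum_subtractf diff_monom[symmetric])

text \<open>
  Division with remainder by \<open>r\<close> recovers the position \<open>(i, j)\<close> from the exponent
  \<open>r * i + j\<close>, so no two entries of the matrix share a monomial.
\<close>

lemma coeff_gen_form:
  assumes "i < r" "j < r"
  shows "coeff (gen_form r A) (r * i + j) = A $$ (i, j)"
proof -
  have inj: "r * i' + j' = r * i + j \<longleftrightarrow> i' = i \<and> j' = j" if "j' < r" for i' j'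
  proof
    assume eq: "r * i' + j' = r * i + j"
    have "(r * i' + j') div r = i'" "(r * i' + j') mod r = j'"
      "(r * i + j) div r = i" "(r * i + j) mod r = j"
      using that assms by auto
    with eq show "i' = i \<and> j' = j" by simp
  qed auto
  have "coeff (gen_form r A) (r * i + j) =
      (\<Sum>i'<r. \<Sum>j'<r. if i' = i \<and> j' = j then A $$ (i', j') else 0)"
    by (auto simp: gen_form_def coeff_sum inj intro!: sum.cong)
  also have "\<dots> = (\<Sum>i'<r. if i' = i then A $$ (i, j) else 0)"
    using assms by (intro sum.cong refl) auto
  also have "\<dots> = A $$ (i, j)"
    using assms by simp
  finally show ?thesis .
qed

lemma gen_form_eq_0_iff:
  assumes "A \<in> carrier_mat r r"
  shows "gen_form r A = 0 \<longleftrightarrow> A = 0\<^sub>m r r"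
proof
  assume "gen_form r A = 0"
  then have "A $$ (i, j) = 0" if "i < r" "j < r" for i j
    using coeff_gen_form[OF that, of A] by simp
  with assms show "A = 0\<^sub>m r r" by (intro eq_matI) auto
qed (simp add: gen_form_def)

section \<open>The lower bound\<close>

text \<open>
  The coefficients \<open>z\<close> are chosen such that \<open>u = (\<Sum>w\<in>W. z w * x w)\<close> has \<open>v\<close> as a right
  and \<open>f\<close> as a left eigenvector. The two eigenvalues agree because \<open>f v \<noteq> 0\<close>, and then they
  cancel in \<open>f (u y) v - f (y u) v\<close>. Entry \<open>0\<close> of \<open>v\<close> and of \<open>f\<close> is \<open>1\<close>, so each
  eigenvector condition costs \<open>r - 1\<close> equations rather than \<open>r\<close>.
\<close>

lemma ex_commutator_relation:
  fixes x :: "'w \<Rightarrow> 'a::idom mat"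
  assumes fin: "finite W" and card: "2 * (r - 1) < card W" and r: "r \<ge> 1"
    and x: "\<And>w. w \<in> W \<Longrightarrow> x w \<in> carrier_mat r r"
  shows "\<exists>z. (\<exists>w\<in>W. z w \<noteq> 0) \<and>
    (\<forall>y\<in>carrier_mat r r. (\<Sum>w\<in>W. z w * gen_form r (x w * y - y * x w)) = 0)"
proof -
  \<comment> \<open>Equation \<open>(True, l)\<close> compares entries \<open>l\<close> and \<open>0\<close> of \<open>u v\<close>, and \<open>(False, l)\<close>
    those of \<open>f u\<close>.\<close>
  define c where "c = (\<lambda>(b, l) w.
    if b then gen_col r (x w) l - monom 1 l * gen_col r (x w) 0
    else gen_row r (x w) l - monom 1 (r * l) * gen_row r (x w) 0)"
  have "card ((UNIV :: bool set) \<times> {1..<r}) = 2 * (r - 1)"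
    by (simp add: card_cartesian_product)
  with card have "finite ((UNIV :: bool set) \<times> {1..<r})"
    "card ((UNIV :: bool set) \<times> {1..<r}) < card W" by simp_all
  from homogeneous_system_nontrivial_solution[OF this(1) fin this(2), of c]
  obtain z where nz: "\<exists>w\<in>W. z w \<noteq> 0"
    and z: "\<forall>e\<in>UNIV \<times> {1..<r}. (\<Sum>w\<in>W. c e w * z w) = 0"
    by (elim exE conjE)
  \<comment> \<open>\<open>R\<close> is \<open>u v\<close> and \<open>L\<close> is \<open>f u\<close>; the eigenvalues are \<open>R 0\<close> and \<open>L 0\<close>.\<close>
  define R where "R l = (\<Sum>w\<in>W. z w * gen_col r (x w) l)" for l
  define L where "L l = (\<Sum>w\<in>W. z w * gen_row r (x w) l)" for l
  have R: "R l = monom 1 l * R 0" if "l < r" for l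
  proof (cases "l = 0")
    case False
    with that z have "(\<Sum>w\<in>W. c (True, l) w * z w) = 0" by auto
    then show ?thesis
      by (simp add: c_def R_def sum_distrib_left sum_subtractf algebra_simps)
  qed simp
  have L: "L l = monom 1 (r * l) * L 0" if "l < r" for l
  proof (cases "l = 0")
    case False
    with that z have "(\<Sum>w\<in>W. c (False, l) w * z w) = 0" by auto
    then show ?thesis
      by (simp add: c_def L_def sum_distrib_left sum_subtractf algebra_simps)
  qed simp
  have left: "(\<Sum>w\<in>W. z w * gen_form r (x w * y)) = L 0 * gen_form r y"
    if y: "y \<in> carrier_mat r r" for y
  proof -
    have "(\<Sum>w\<in>W. z w * gen_form r (x w * y)) =
        (\<Sum>w\<in>W. \<Sum>l<r. z w * gen_row r (x w) l * gen_col r y l)"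
      using x y by (intro sum.cong refl) (simp add: gen_form_mult sum_distrib_left mult.assoc)
    also have "\<dots> = (\<Sum>l<r. L l * gen_col r y l)"
      by (subst sum.swap) (simp add: L_def sum_distrib_right)
    also have "\<dots> = (\<Sum>l<r. L 0 * (monom 1 (r * l) * gen_col r y l))"
      by (intro sum.cong refl) (subst L, simp_all add: algebra_simps)
    finally show ?thesis by (simp add: gen_form_eq_sum_col sum_distrib_left)
  qed
  have right: "(\<Sum>w\<in>W. z w * gen_form r (y * x w)) = R 0 * gen_form r y"
    if y: "y \<in> carrier_mat r r" for y
  proof -
    have "(\<Sum>w\<in>W. z w * gen_form r (y * x w)) =
        (\<Sum>w\<in>W. \<Sum>l<r. gen_row r y l * (z w * gen_col r (x w) l))"
      using x y by (intro sum.cong refl) (simp add: gen_form_mult sum_distrib_left algebra_simps)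
    also have "\<dots> = (\<Sum>l<r. gen_row r y l * R l)"
      by (subst sum.swap) (simp add: R_def sum_distrib_left)
    also have "\<dots> = (\<Sum>l<r. R 0 * (gen_row r y l * monom 1 l))"
      by (intro sum.cong refl) (subst R, simp_all add: algebra_simps)
    finally show ?thesis by (simp add: gen_form_eq_sum_row sum_distrib_left)
  qed
  \<comment> \<open>Both sides are \<open>f u v\<close>, and \<open>f v\<close> is the value of the form at the identity matrix.\<close>
  have "L 0 * gen_form r (1\<^sub>m r) = R 0 * gen_form r (1\<^sub>m r)"
    using left[of "1\<^sub>m r"] right[of "1\<^sub>m r"] x
    by (simp cong: sum.cong add: left_mult_one_mat[OF x] right_mult_one_mat[OF x])
  moreover have "(1\<^sub>m r :: 'a mat) \<noteq> 0\<^sub>m r r"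
  proof
    assume "(1\<^sub>m r :: 'a mat) = 0\<^sub>m r r"
    then have "(1\<^sub>m r :: 'a mat) $$ (0, 0) = 0\<^sub>m r r $$ (0, 0)" by simp
    with r show False by simp
  qed
  ultimately have LR: "L 0 = R 0" by (simp add: gen_form_eq_0_iff)
  show ?thesis
  proof (intro exI[of _ z] conjI ballI nz)
    fix y :: "'a mat" assume y: "y \<in> carrier_mat r r"
    have "(\<Sum>w\<in>W. z w * gen_form r (x w * y - y * x w)) =
        (\<Sum>w\<in>W. z w * gen_form r (x w * y)) - (\<Sum>w\<in>W. z w * gen_form r (y * x w))"
      unfolding sum_subtractf[symmetric]
      by (intro sum.cong refl) (simp add: gen_form_diff[OF mult_carrier_mat[OF x y] mult_carrier_mat[OF y x]] right_diff_distrib)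
    then show "(\<Sum>w\<in>W. z w * gen_form r (x w * y - y * x w)) = 0"
      using left[OF y] right[OF y] LR by simp
  qed
qed

lemma minus_mat_eq_0_iff:
  fixes A B :: "'a::ring mat"
  assumes "A \<in> carrier_mat m n" "B \<in> carrier_mat m n"
  shows "A - B = 0\<^sub>m m n \<longleftrightarrow> A = B"
proof
  assume eq: "A - B = 0\<^sub>m m n"
  have "A $$ (i, j) = B $$ (i, j)" if "i < m" "j < n" for i j
    using arg_cong[OF eq, of "\<lambda>M. M $$ (i, j)"] assms that by simp
  with assms show "A = B" by (intro eq_matI) auto
qed (use assms in simp)

text \<open>
  The matrix \<open>x (\<sigma> w)\<close> tests for \<open>w\<close>: bracketing a relation from
  \<open>ex_commutator_relation\<close> with it kills every term but that of \<open>w\<close>.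
\<close>

lemma matching_commutators_bound:
  fixes x :: "'w \<Rightarrow> 'a::idom mat"
  assumes fin: "finite W" and r: "r \<ge> 1"
    and x: "\<And>w. w \<in> W \<Longrightarrow> x w \<in> carrier_mat r r"
    and \<sigma>: "\<And>w. w \<in> W \<Longrightarrow> \<sigma> w \<in> W"
    and comm: "\<And>v w. v \<in> W \<Longrightarrow> w \<in> W \<Longrightarrow> x v * x (\<sigma> w) = x (\<sigma> w) * x v \<longleftrightarrow> v \<noteq> w"
  shows "card W \<le> 2 * (r - 1)"
proof (rule ccontr)
  assume "\<not> ?thesis"
  then have lt: "2 * (r - 1) < card W" by simp
  have "\<exists>z. (\<exists>w\<in>W. z w \<noteq> 0) \<and>
      (\<forall>y\<in>carrier_mat r r. (\<Sum>w\<in>W. z w * gen_form r (x w * y - y * x w)) = 0)"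
    using fin lt r x by (rule ex_commutator_relation)
  then obtain z where nz: "\<exists>w\<in>W. z w \<noteq> 0"
    and z: "\<forall>y\<in>carrier_mat r r. (\<Sum>w\<in>W. z w * gen_form r (x w * y - y * x w)) = 0"
    by (elim exE conjE)
  from nz obtain w where w: "w \<in> W" "z w \<noteq> 0" by auto
  let ?K = "\<lambda>v. x v * x (\<sigma> w) - x (\<sigma> w) * x v"
  have car: "?K v \<in> carrier_mat r r" if "v \<in> W" for v
    using x[OF that] x[OF \<sigma>[OF w(1)]] by auto
  have zero: "gen_form r (?K v) = 0 \<longleftrightarrow> v \<noteq> w" if v: "v \<in> W" for v
  proof -
    have m: "x v * x (\<sigma> w) \<in> carrier_mat r r" "x (\<sigma> w) * x v \<in> carrier_mat r r"
      using x[OF v] x[OF \<sigma>[OF w(1)]] by auto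
    have "?K v = 0\<^sub>m r r \<longleftrightarrow> x v * x (\<sigma> w) = x (\<sigma> w) * x v"
      using m by (rule minus_mat_eq_0_iff)
    then show ?thesis
      using comm[OF v w(1)] gen_form_eq_0_iff[OF car[OF v]] by simp
  qed
  have "0 = (\<Sum>v\<in>W. z v * gen_form r (?K v))"
    using bspec[OF z x[OF \<sigma>[OF w(1)]]] by simp
  also have "\<dots> = (\<Sum>v\<in>W. if v = w then z w * gen_form r (?K w) else 0)"
    by (intro sum.cong refl) (use zero in auto)
  also have "\<dots> = z w * gen_form r (?K w)" using fin w by simp
  finally show False using w zero[OF w(1)] by simp
qed

text \<open>
  The graph used here joins \<open>2 * i\<close> with \<open>2 * i + 1\<close>; for odd \<open>n\<close> the last vertex is
  isolated.
\<close>

lemma less_of_all_graphs_representable: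
  assumes rep: "all_graphs_representable TYPE('k::field) n r" and r: "r \<ge> 1"
  shows "n div 2 < r"
proof -
  define \<sigma> :: "nat \<Rightarrow> nat" where "\<sigma> i = (if even i then i + 1 else i - 1)" for i
  define W where "W = {..<2 * (n div 2)}"
  define G where "G = \<lparr>pverts = {..<n}, parcs = {(i, \<sigma> i) |i. i \<in> W}\<rparr>"
  have \<sigma>\<sigma>: "\<sigma> (\<sigma> i) = i" and \<sigma>_neq: "\<sigma> i \<noteq> i" for i
    by (auto simp: \<sigma>_def elim: oddE)
  have \<sigma>W: "\<sigma> i \<in> W" if "i \<in> W" for i
    using that by (auto simp: \<sigma>_def W_def elim!: evenE oddE)
  have Wn: "W \<subseteq> {..<n}" by (auto simp: W_def)
  have "pair_graph G"
  proof
    show "finite (pverts G)" by (simp add: G_def)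
    show "finite (parcs G)" by (simp add: G_def W_def)
    have "sym (parcs G)"
    proof (rule symI)
      fix v w assume "(v, w) \<in> parcs G"
      then have "v \<in> W" "w = \<sigma> v" by (auto simp: G_def)
      then have "w \<in> W" "v = \<sigma> w" using \<sigma>W \<sigma>\<sigma> by simp_all
      then show "(w, v) \<in> parcs G" by (simp add: G_def)
    qed
    then show "symmetric (with_proj G)"
      by (simp add: symmetric_def)
  next
    fix e assume "e \<in> parcs G"
    then obtain v where v: "e = (v, \<sigma> v)" "v \<in> W" by (auto simp: G_def)
    then show "fst e \<in> pverts G" "snd e \<in> pverts G" "fst e \<noteq> snd e"
      using subsetD[OF Wn v(2)] subsetD[OF Wn \<sigma>W[OF v(2)]] \<sigma>_neq[of v] by (simp_all add: G_def)
  qed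
  moreover have "card (pverts G) = n" by (simp add: G_def)
  ultimately obtain x :: "nat \<Rightarrow> 'k mat" where "represents x G r"
    using rep by (auto simp: all_graphs_representable_def)
  then have x: "\<And>w. w < n \<Longrightarrow> x w \<in> carrier_mat r r"
    and arcs: "\<And>v w. v < n \<Longrightarrow> w < n \<Longrightarrow> v \<noteq> w \<Longrightarrow>
      v \<in> W \<and> w = \<sigma> v \<longleftrightarrow> x v * x w \<noteq> x w * x v"
    by (auto simp: represents_def G_def)
  have "card W \<le> 2 * (r - 1)"
  proof (rule matching_commutators_bound[where x = x and \<sigma> = \<sigma>])
    show "x v * x (\<sigma> w) = x (\<sigma> w) * x v \<longleftrightarrow> v \<noteq> w" if "v \<in> W" "w \<in> W" for v w
    proof (cases "v = \<sigma> w")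
      case True then show ?thesis using \<sigma>_neq by simp
    next
      case False
      have "v < n" "\<sigma> w < n"
        using subsetD[OF Wn that(1)] subsetD[OF Wn \<sigma>W[OF that(2)]] by simp_all
      moreover have "\<sigma> w = \<sigma> v \<longleftrightarrow> v = w" using \<sigma>\<sigma> by metis
      ultimately show ?thesis using arcs[of v "\<sigma> w"] False that(1) by auto
    qed
  qed (use x \<sigma>W Wn r in \<open>auto simp: W_def\<close>)
  then show ?thesis using r by (simp add: W_def)
qed

section \<open>The upper bound\<close>

text \<open>
  Rows and columns are numbered from \<open>0\<close> to \<open>n\<close>, so \<open>p\<close> and \<open>q\<close> are read at the
  \<open>n - 1\<close> inner indices \<open>1, \<dots>, n - 1\<close> only.
\<close>

definition heisenberg :: "nat \<Rightarrow> (nat \<Rightarrow> 'a::comm_ring_1) \<Rightarrow> (nat \<Rightarrow> 'a) \<Rightarrow> 'a mat" where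
  "heisenberg n p q = mat (n + 1) (n + 1) (\<lambda>(a, b).
     if a = 0 \<and> 0 < b \<and> b < n then p b else if b = n \<and> 0 < a \<and> a < n then q a else 0)"

lemma heisenberg_mult:
  "heisenberg n p q * heisenberg n p' q' = mat (n + 1) (n + 1) (\<lambda>(a, b).
     if a = 0 \<and> b = n then \<Sum>l=1..<n. p l * q' l else 0)"
proof (rule eq_matI, goal_cases)
  case (1 a b)
  then have ab: "a < n + 1" "b < n + 1" by auto
  have "(heisenberg n p q * heisenberg n p' q') $$ (a, b) =
      (\<Sum>l=0..<n + 1. heisenberg n p q $$ (a, l) * heisenberg n p' q' $$ (l, b))"
    using ab by (simp add: heisenberg_def scalar_prod_def)
  also have "\<dots> = (\<Sum>l=0..<n + 1. if l \<in> {1..<n} then (if a = 0 \<and> b = n then p l * q' l else 0) else 0)"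
    using ab by (intro sum.cong refl) (auto simp: heisenberg_def)
  also have "\<dots> = (\<Sum>l\<in>{0..<n + 1} \<inter> {1..<n}. if a = 0 \<and> b = n then p l * q' l else 0)"
    by (rule sum.inter_restrict[symmetric]) simp
  also have "{0..<n + 1} \<inter> {1..<n} = {1..<n}" by auto
  finally show ?case using ab by simp
qed (simp_all add: heisenberg_def)

text \<open>
  Each product of two of the chosen matrices is \<open>0\<close> or the corner unit, and of the two
  products \<open>x v * x w\<close> and \<open>x w * x v\<close> the one with the later vertex first is always \<open>0\<close>.
  The vertex numbered \<open>n\<close> has no inner index, which makes its row \<open>p\<close> vanish.
\<close>

lemma all_graphs_representable_Suc:
  "all_graphs_representable TYPE('k::field) n (n + 1)"
  unfolding all_graphs_representable_def
proof (intro allI impI, elim conjE)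
  fix G :: "nat pair_pre_digraph"
  assume G: "pair_graph G" and card: "card (pverts G) = n"
  then interpret pair_graph G by simp
  obtain h where h: "bij_betw h (pverts G) {1..n}"
    using finite_same_card_bij[of "pverts G" "{1..n}"] card by auto
  define E where "E v w \<longleftrightarrow> (v, w) \<in> parcs G" for v w
  define x :: "nat \<Rightarrow> 'k mat" where "x w = heisenberg n (\<lambda>l. of_bool (l = h w))
    (\<lambda>l. of_bool (\<exists>v\<in>pverts G. h v = l \<and> l < h w \<and> E v w))" for w
  define S :: "'k \<Rightarrow> 'k mat"
    where "S s = mat (n + 1) (n + 1) (\<lambda>(a, b). if a = 0 \<and> b = n then s else 0)" for s
  have S: "S s = S t \<longleftrightarrow> s = t" for s t
  proof
    assume "S s = S t"
    then have "S s $$ (0, n) = S t $$ (0, n)" by simp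
    then show "s = t" by (simp add: S_def)
  qed simp
  have mult: "x v * x w = S (of_bool (h v < h w \<and> E v w))"
    if vw: "v \<in> pverts G" "w \<in> pverts G" for v w
  proof -
    have hv: "1 \<le> h v" "h w \<le> n" using h vw by (auto simp: bij_betw_def)
    have inj: "u = v" if "u \<in> pverts G" "h u = h v" for u
      using h vw that by (auto simp: bij_betw_def inj_on_def)
    have "(\<Sum>l=1..<n. of_bool (l = h v) *
        of_bool (\<exists>u\<in>pverts G. h u = l \<and> l < h w \<and> E u w) :: 'k) =
      (\<Sum>l=1..<n. if l = h v then of_bool (h v < h w \<and> E v w) else 0)"
      by (intro sum.cong refl) (use vw inj in auto)
    also have "\<dots> = of_bool (h v < h w \<and> E v w)"
      using hv by auto
    finally show ?thesis by (simp only: x_def heisenberg_mult S_def)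
  qed
  have "represents x G (n + 1)"
    unfolding represents_def
  proof (intro conjI ballI impI)
    fix w show "x w \<in> carrier_mat (n + 1) (n + 1)" by (simp add: x_def heisenberg_def)
  next
    fix v w assume vw: "v \<in> pverts G" "w \<in> pverts G" "v \<noteq> w"
    have "h v \<noteq> h w" using h vw by (auto simp: bij_betw_def inj_on_def)
    moreover have "E v w \<longleftrightarrow> E w v"
      using arcs_symmetric by (auto simp: E_def)
    ultimately show "(v, w) \<in> parcs G \<longleftrightarrow> x v * x w \<noteq> x w * x v"
      using vw by (auto simp: mult S E_def[symmetric])
  qed
  then show "\<exists>x :: nat \<Rightarrow> 'k mat. represents x G (n + 1)" by blast
qed

theorem mainTheorem4:
  fixes n :: nat
  assumes "finite (UNIV :: 'k::field set) \<longrightarrow> card (UNIV :: 'k set) > 2"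
    and "n \<ge> 1"
  shows "n div 2 + 1 \<le> mat_num TYPE('k) n \<and> mat_num TYPE('k) n \<le> n + 1"
proof -
  have ok: "n + 1 \<ge> 1 \<and> all_graphs_representable TYPE('k) n (n + 1)"
    using all_graphs_representable_Suc by simp
  have "mat_num TYPE('k) n \<ge> 1 \<and> all_graphs_representable TYPE('k) n (mat_num TYPE('k) n)"
    unfolding mat_num_def using ok by (rule LeastI)
  then have "n div 2 < mat_num TYPE('k) n"
    using less_of_all_graphs_representable by blast
  moreover have "mat_num TYPE('k) n \<le> n + 1"
    unfolding mat_num_def using ok by (rule Least_le)
  ultimately show ?thesis by simp
qed

end
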